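(* Let $\lambda > \aleph_1$ be a regular cardinal such that $\lambda$ is not the successor of a singular cardinal of cofinality $\aleph_0$. Let $G$ be a $\lambda$-free abelian group with $|G| = \lambda$. Then there is a free (abelian) subgroup $G' \subseteq G$ with $|G'| = \lambda$.
   Context: An abelian group $G$ is called $\lambda$-free (for an infinite cardinal $\lambda$) if every subgroup of $G$ of cardinality less than $\lambda$ is a free abelian group. "Free" for a subgroup of an abelian group means free as an abelian group (i.e. free as a $\mathbb{Z}$-module). *)

theory Defs
  imports "HOL-Algebra.Free_Abelian_Groups"
begin

unbundle cardinal_syntax

text \<open>Every basis of a free abelian group is a subset of its carrier, so it is no restriction
  to take the index set \<open>S\<close> over the element type of \<open>G\<close>.\<close>

definition is_free_abelian :: "('a, 'm) monoid_scheme \<Rightarrow> bool" where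
  "is_free_abelian G \<longleftrightarrow> comm_group G \<and> (\<exists>S :: 'a set. G \<cong> free_Abelian_group S)"

definition cardinal_free_abelian :: "'b rel \<Rightarrow> ('a, 'm) monoid_scheme \<Rightarrow> bool" where
  "cardinal_free_abelian lam G \<longleftrightarrow>
     comm_group G \<and>
     (\<forall>H. subgroup H G \<and> |H| <o lam \<longrightarrow> is_free_abelian (G\<lparr>carrier := H\<rparr>))"

text \<open>As usual in Isabelle/HOL, a cardinal is a minimal well-order on its field, and equality of
  cardinals is order isomorphism \<open>=o\<close>. The library's \<open>cofinal\<close> asks for strictly larger
  elements, which agrees with weak cofinality on infinite cardinals.\<close>

definition has_cofinality :: "'b rel \<Rightarrow> 'c rel \<Rightarrow> bool" where
  "has_cofinality r k \<longleftrightarrow> Card_order k \<and>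
     (\<exists>K \<subseteq> Field r. cofinal K r \<and> |K| =o k) \<and>
     (\<forall>K \<subseteq> Field r. cofinal K r \<longrightarrow> k \<le>o |K| )"

definition singularCard :: "'b rel \<Rightarrow> bool" where
  "singularCard r \<longleftrightarrow> Cinfinite r \<and> \<not> regularCard r"

text \<open>If \<open>lam\<close> is the successor of any cardinal, then that cardinal is smaller than \<open>lam\<close> and
  hence has a copy on the type of \<open>lam\<close>; so \<open>mu\<close> may be taken over the same type.\<close>

definition succ_of_singular_cof_omega :: "'b rel \<Rightarrow> bool" where
  "succ_of_singular_cof_omega lam \<longleftrightarrow>
     (\<exists>mu :: 'b rel. singularCard mu \<and> has_cofinality mu natLeq \<and> lam =o cardSuc mu)"

end

theory Submission
  imports Defs "HOL-Library.Countable_Set_Type"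
begin

text \<open>A maximal independent subset of an abelian group generates a free subgroup \<open>F\<close> such that every
  element \<open>g\<close> has a nonzero multiple in \<open>F\<close>. Cyclic subgroups of \<open>G\<close> are countable, hence free, so
  \<open>G\<close> is torsion-free and \<open>g\<close> is determined by \<open>n\<close> together with the \<open>n\<close>-th multiple of \<open>g\<close>.
  Therefore \<open>|G|\<close> is at most \<open>\<aleph>\<^sub>0 * |F|\<close>, and as \<open>|G|\<close> is uncountable, \<open>|F| = |G|\<close>.\<close>

text \<open>An isomorphism turns the \<open>n\<close>-th power into \<open>n\<close> times a
  finitely supported integer-valued function, and a nonzero integer can be cancelled in each
  coordinate.\<close>

lemma is_free_abelian_torsion_free:
  fixes n :: int
  assumes "is_free_abelian G" and x: "x \<in> carrier G" "x [^]\<^bsub>G\<^esub> n = \<one>\<^bsub>G\<^esub>" and "n \<noteq> 0"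
  shows "x = \<one>\<^bsub>G\<^esub>"
proof -
  obtain S :: "'a set" and f where "group G" and f: "f \<in> iso G (free_Abelian_group S)"
    using assms(1) by (auto simp: is_free_abelian_def is_iso_def comm_group_def)
  then interpret f: group_hom G "free_Abelian_group S" f
    by (auto simp: group_hom_def group_hom_axioms_def iso_def)
  have "Poly_Mapping.keys (f x) \<subseteq> S"
    using f.hom_closed[OF x(1)] by simp
  then have "frag_cmul n (f x) = f (x [^]\<^bsub>G\<^esub> n)"
    using f.hom_int_pow[OF x(1)] int_pow_free_Abelian_group by metis
  also have "\<dots> = 0"
    using x(2) f.hom_one by simp
  finally have "f x = f \<one>\<^bsub>G\<^esub>"
    using \<open>n \<noteq> 0\<close> f.hom_one by (simp add: poly_mapping_eq_iff fun_eq_iff)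
  then show ?thesis
    using f x(1) f.G.one_closed by (metis inj_onD iso_iff)
qed

text \<open>\<open>F\<close> is the span of a maximal independent set \<open>B\<close>. Torsion in
  \<open>G\<close> does no harm: \<open>B\<close> may be empty and \<open>F\<close> trivial.\<close>

lemma (in comm_group) free_subgroup_of_full_rank:
  obtains F where "subgroup F G" "is_free_abelian (G\<lparr>carrier := F\<rparr>)"
    "\<And>g. g \<in> carrier G \<Longrightarrow> \<exists>n::int. n \<noteq> 0 \<and> g [^] n \<in> F"
proof -
  \<comment> \<open>\<open>h\<close> evaluates formal integer combinations of elements of
    \<open>G\<close> inside \<open>G\<close>.\<close>
  obtain h where h: "h \<in> hom (free_Abelian_group (carrier G)) G"
    and h_of: "\<And>x. x \<in> carrier G \<Longrightarrow> h (frag_of x) = x"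
    using free_Abelian_group_universal[of "\<lambda>x. x" "carrier G"] by auto
  interpret h: group_hom "free_Abelian_group (carrier G)" G h
    using h by (auto simp: group_hom_def group_hom_axioms_def)
  have h_closed: "h c \<in> carrier G" if "Poly_Mapping.keys c \<subseteq> carrier G" for c
    using h.hom_closed that by simp
  have h_add: "h (c + d) = h c \<otimes> h d"
    if "Poly_Mapping.keys c \<subseteq> carrier G" "Poly_Mapping.keys d \<subseteq> carrier G" for c d
    using h.hom_mult that by simp
  have h_uminus: "h (- c) = inv h c" if "Poly_Mapping.keys c \<subseteq> carrier G" for c
    using h.hom_inv that by simp
  have h_cmul: "h (frag_cmul n (frag_of g)) = g [^] n" if "g \<in> carrier G" for n g
    using h.hom_int_pow[of "frag_of g" n] that by (simp add: h_of)
  \<comment> \<open>Independence over the integers: no nonzero formal combination supported in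
    \<open>B\<close> evaluates to the identity.\<close>
  define indep where
    "indep B \<longleftrightarrow> B \<subseteq> carrier G \<and> (\<forall>c. Poly_Mapping.keys c \<subseteq> B \<longrightarrow> h c = \<one> \<longrightarrow> c = 0)" for B
  have "\<exists>B\<in>Collect indep. \<forall>X\<in>Collect indep. B \<subseteq> X \<longrightarrow> X = B"
  proof (rule subset_Zorn_nonempty)
    show "Collect indep \<noteq> {}"
      by (auto simp: indep_def intro!: exI[of _ "{}"])
    fix C
    assume "C \<noteq> {}" and C: "subset.chain (Collect indep) C"
    have "c = 0" if "Poly_Mapping.keys c \<subseteq> \<Union>C" "h c = \<one>" for c
    proof -
      \<comment> \<open>A formal combination has finite support, so one member of the chain already
        contains it.\<close>
      have "\<exists>B\<in>C. Poly_Mapping.keys c \<subseteq> B"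
        by (rule finite_subset_Union_chain[OF finite_keys that(1) \<open>C \<noteq> {}\<close> C]) auto
      then show ?thesis
        using that(2) C by (auto simp: subset.chain_def indep_def)
    qed
    moreover have "\<Union>C \<subseteq> carrier G"
      using C by (fastforce simp: subset.chain_def indep_def)
    ultimately show "\<Union>C \<in> Collect indep"
      by (simp add: indep_def)
  qed
  then obtain B where B: "indep B" and B_max: "\<And>X. indep X \<Longrightarrow> B \<subseteq> X \<Longrightarrow> X = B"
    by auto
  have BG: "B \<subseteq> carrier G"
    using B by (simp add: indep_def)
  have "h \<in> hom (free_Abelian_group B) G"
    using BG h by (auto simp: hom_def subset_iff)
  then interpret hB: group_hom "free_Abelian_group B" G h
    by (auto simp: group_hom_def group_hom_axioms_def)
  define F where "F = h ` carrier (free_Abelian_group B)"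
  have sub: "subgroup F G"
    unfolding F_def by (rule hB.img_is_subgroup)
  \<comment> \<open>Independence of \<open>B\<close> says exactly that \<open>h\<close> has trivial
    kernel on combinations supported in \<open>B\<close>.\<close>
  have "inj_on h (carrier (free_Abelian_group B))"
    using B by (intro hB.inj_iff_trivial_ker[THEN iffD2]) (use hB.hom_one in \<open>auto simp: indep_def kernel_def\<close>)
  then have "h \<in> iso (free_Abelian_group B) (G\<lparr>carrier := F\<rparr>)"
    using hB.homh by (auto simp: iso_def hom_def F_def bij_betw_def)
  then have "G\<lparr>carrier := F\<rparr> \<cong> free_Abelian_group B"
    using group.iso_sym group_free_Abelian_group is_isoI by blast
  moreover have "comm_group (G\<lparr>carrier := F\<rparr>)"
    by (rule group.group_comm_groupI[OF subgroup_imp_group[OF sub]])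
      (use subgroup.subset[OF sub] m_comm in auto)
  ultimately have free: "is_free_abelian (G\<lparr>carrier := F\<rparr>)"
    unfolding is_free_abelian_def by blast
  have "\<exists>n::int. n \<noteq> 0 \<and> g [^] n \<in> F" if g: "g \<in> carrier G" for g
  proof (cases "g \<in> B")
    case True
    then have "g [^] (1::int) \<in> F"
      using g by (force simp: F_def h_of intro!: image_eqI[of _ h "frag_of g"])
    then show ?thesis
      by (metis one_neq_zero)
  next
    case False
    then have "\<not> indep (insert g B)"
      using B_max by blast
    \<comment> \<open>By maximality, adding \<open>g\<close> creates a nontrivial relation
      \<open>c\<close>. Its coefficient at \<open>g\<close> will be the required exponent
      \<open>n\<close>, and the remainder \<open>d\<close> is supported in \<open>B\<close>.\<close>
    then obtain c where c: "Poly_Mapping.keys c \<subseteq> insert g B" "h c = \<one>" "c \<noteq> 0"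
      using g BG by (auto simp: indep_def)
    define n where "n = Poly_Mapping.lookup c g"
    define d where "d = c - frag_cmul n (frag_of g)"
    have "Poly_Mapping.lookup d g = 0"
      by (simp add: d_def n_def lookup_minus)
    moreover have "Poly_Mapping.keys d \<subseteq> insert g B"
      using keys_diff[of c] keys_cmul[of n "frag_of g"] c(1) by (fastforce simp: d_def)
    ultimately have d: "Poly_Mapping.keys d \<subseteq> B"
      by (metis in_keys_iff subset_insert)
    have "c = frag_cmul n (frag_of g) + d"
      by (simp add: d_def)
    moreover have kn: "Poly_Mapping.keys (frag_cmul n (frag_of g)) \<subseteq> carrier G"
      using keys_cmul[of n "frag_of g"] g by auto
    moreover have dG: "Poly_Mapping.keys d \<subseteq> carrier G"
      using d BG by auto
    ultimately have "g [^] n \<otimes> h d = \<one>"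
      using c(2) h_add h_cmul[OF g] by metis
    then have "g [^] n = h (- d)"
      using h_uminus[OF dG] h_closed[OF dG] g by (metis int_pow_closed inv_equality inv_inv inv_closed)
    then have "g [^] n \<in> F"
      using d by (simp add: F_def)
    \<comment> \<open>If \<open>n\<close> were 0, then \<open>c = d\<close> would be a nontrivial
      relation within \<open>B\<close>.\<close>
    moreover have "n \<noteq> 0"
      using c B d by (auto simp: indep_def d_def)
    ultimately show ?thesis
      by blast
  qed
  then show ?thesis
    using that sub free by blast
qed

text \<open>Choose a nonzero exponent \<open>N g\<close> for each \<open>g\<close> and send
  \<open>g\<close> to the pair of \<open>N g\<close> and its power in \<open>F\<close>. Two elements
  with the same pair have a quotient killed by a nonzero exponent, so torsion-freeness makes them
  equal.\<close>

lemma (in comm_group) card_of_carrier_le_if_full_rank: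
  assumes "F \<subseteq> carrier G"
    and tf: "\<And>g n::int. g \<in> carrier G \<Longrightarrow> g [^] n = \<one> \<Longrightarrow> n \<noteq> 0 \<Longrightarrow> g = \<one>"
    and rank: "\<And>g. g \<in> carrier G \<Longrightarrow> \<exists>n::int. n \<noteq> 0 \<and> g [^] n \<in> F"
  shows "|carrier G| \<le>o |(UNIV::int set) \<times> F|"
proof -
  obtain N :: "'a \<Rightarrow> int" where N: "\<And>g. g \<in> carrier G \<Longrightarrow> N g \<noteq> 0 \<and> g [^] N g \<in> F"
    using rank by metis
  have "inj_on (\<lambda>g. (N g, g [^] N g)) (carrier G)"
  proof (rule inj_onI)
    fix x y
    assume xy: "x \<in> carrier G" "y \<in> carrier G" and "(N x, x [^] N x) = (N y, y [^] N y)"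
    then have "N y = N x" "x [^] N x = y [^] N x"
      by auto
    then have "(x \<otimes> inv y) [^] N x = \<one>"
      using xy by (simp add: int_pow_distrib int_pow_inv)
    then have "x \<otimes> inv y = \<one>"
      using tf N xy by blast
    then show "x = y"
      using xy by (metis inv_equality inv_inv inv_closed)
  qed
  moreover have "(\<lambda>g. (N g, g [^] N g)) ` carrier G \<subseteq> UNIV \<times> F"
    using N by auto
  ultimately show ?thesis
    using card_of_ordLeq by blast
qed

theorem mainTheorem1:
  fixes lam :: "'b rel" and G :: "('a, 'm) monoid_scheme"
  assumes "Cinfinite lam" and "regularCard lam"
    and "cardSuc natLeq <o lam"
    and "\<not> succ_of_singular_cof_omega lam"
    and "cardinal_free_abelian lam G"
    and "|carrier G| =o lam"
  shows "\<exists>G'. subgroup G' G \<and> is_free_abelian (G\<lparr>carrier := G'\<rparr>) \<and> |G'| =o lam"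
proof -
  interpret comm_group G
    using assms(5) by (simp add: cardinal_free_abelian_def)
  have omega_less: "natLeq <o lam"
    using assms(3) cardSuc_greater natLeq_Card_order ordLess_transitive by blast
  \<comment> \<open>The element type of \<open>A\<close> is left open, since this serves both for
    cyclic subgroups of \<open>G\<close> and for the integers.\<close>
  have countable_less: "|A| <o lam" if "countable A" for A :: "'c set"
    using that omega_less countable_card_le_natLeq ordLeq_ordLess_trans by blast
  have tf: "g = \<one>\<^bsub>G\<^esub>" if g: "g \<in> carrier G" and n: "g [^]\<^bsub>G\<^esub> n = \<one>\<^bsub>G\<^esub>" "n \<noteq> 0" for g and n :: int
  proof -
    \<comment> \<open>The cyclic subgroup of \<open>g\<close> is countable, so the freeness
      assumption on small subgroups applies to it.\<close>
    let ?H = "generate G {g}"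
    have "?H = range (\<lambda>k::int. g [^]\<^bsub>G\<^esub> k)"
      using generate_pow[OF g] by auto
    then have "|?H| <o lam"
      by (intro countable_less) auto
    moreover have H: "subgroup ?H G"
      using generate_is_subgroup g by simp
    ultimately have "is_free_abelian (G\<lparr>carrier := ?H\<rparr>)"
      using assms(5) by (simp add: cardinal_free_abelian_def)
    moreover have gH: "g \<in> ?H"
      by (simp add: generate.incl)
    moreover have "g [^]\<^bsub>G\<lparr>carrier := ?H\<rparr>\<^esub> n = \<one>\<^bsub>G\<^esub>"
      using int_pow_consistent[OF H gH] n(1) by simp
    ultimately show ?thesis
      using is_free_abelian_torsion_free[of "G\<lparr>carrier := ?H\<rparr>" g n] n(2) by simp
  qed
  obtain F where F: "subgroup F G" "is_free_abelian (G\<lparr>carrier := F\<rparr>)"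
    and rank: "\<And>g. g \<in> carrier G \<Longrightarrow> \<exists>n::int. n \<noteq> 0 \<and> g [^]\<^bsub>G\<^esub> n \<in> F"
    using free_subgroup_of_full_rank by blast
  have FG: "F \<subseteq> carrier G"
    using F(1) subgroup.subset by blast
  have "\<not> |F| <o lam"
  proof
    assume "|F| <o lam"
    moreover have "|UNIV :: int set| <o lam"
      by (rule countable_less) simp
    moreover have "\<not> finite (Field lam)" "Card_order lam"
      using assms(1) by (auto simp: cinfinite_def)
    \<comment> \<open>A product of two sets smaller than the infinite cardinal \<open>lam\<close> is
      again smaller than \<open>lam\<close>, yet all of \<open>G\<close> embeds into this
      one.\<close>
    ultimately have "|(UNIV::int set) \<times> F| <o lam"
      using card_of_Times_ordLess_infinite_Field by blast
    moreover have "|carrier G| \<le>o |(UNIV::int set) \<times> F|"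
      using card_of_carrier_le_if_full_rank[OF FG tf rank] .
    ultimately show False
      using assms(6) by (meson not_ordLess_ordIso ordLeq_ordLess_trans)
  qed
  moreover have "|F| \<le>o lam"
    using card_of_mono1[OF FG] assms(6) ordLeq_ordIso_trans by blast
  ultimately have "|F| =o lam"
    using ordLeq_iff_ordLess_or_ordIso by blast
  with F show ?thesis
    by blast
qed

end
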